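(* There is no perfect Euler box one of whose side lengths is a semiprime. That is, there do not exist positive integers $a,b,c$ such that $a^2+b^2$, $a^2+c^2$, $b^2+c^2$ and $a^2+b^2+c^2$ are all perfect squares and such that at least one of $a,b,c$ is a product of exactly two primes.
   Context: A perfect Euler box is a rectangular cuboid with positive integer side lengths $a,b,c$ whose three face diagonals $\sqrt{a^2+b^2},\sqrt{a^2+c^2},\sqrt{b^2+c^2}$ and whose space diagonal $\sqrt{a^2+b^2+c^2}$ are all integers. A semiprime is an integer of the form $pq$ with $p,q$ primes. *)

theory Defs
  imports Complex_Main "HOL-Computational_Algebra.Nth_Powers"
begin

definition perfect_euler_box :: "nat \<Rightarrow> nat \<Rightarrow> nat \<Rightarrow> bool" where
  "perfect_euler_box a b c \<longleftrightarrow>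
     a > 0 \<and> b > 0 \<and> c > 0 \<and>
     sqrt (real (a^2 + b^2)) \<in> \<int> \<and>
     sqrt (real (a^2 + c^2)) \<in> \<int> \<and>
     sqrt (real (b^2 + c^2)) \<in> \<int> \<and>
     sqrt (real (a^2 + b^2 + c^2)) \<in> \<int>"

(* The two primes may coincide, so squares of primes are semiprimes. *)
definition semiprime :: "nat \<Rightarrow> bool" where
  "semiprime n \<longleftrightarrow> (\<exists>p q. prime p \<and> prime q \<and> n = p * q)"

lemma sqrt_of_nat_in_Ints_iff: "sqrt (real n) \<in> \<int> \<longleftrightarrow> is_square n"
proof
  assume "sqrt (real n) \<in> \<int>"
  then obtain k where k: "sqrt (real n) = of_int k"
    by (elim Ints_cases)
  then have "k \<ge> 0"
    by (metis of_int_0_le_iff of_nat_0_le_iff real_sqrt_ge_zero)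
  then have "sqrt (real n) = real (nat k)"
    using k by simp
  then have "real n = (real (nat k))^2"
    by (metis of_nat_0_le_iff real_sqrt_pow2)
  then have "n = nat k ^ 2"
    by (metis of_nat_eq_iff of_nat_power)
  then show "is_square n"
    by (auto simp: is_nth_power_def)
next
  assume "is_square n"
  then obtain k where "n = k ^ 2"
    by (auto simp: is_nth_power_def)
  then show "sqrt (real n) \<in> \<int>"
    by simp
qed

lemma perfect_euler_box_iff_squares:
  "perfect_euler_box a b c \<longleftrightarrow>
     a > 0 \<and> b > 0 \<and> c > 0 \<and>
     is_square (a^2 + b^2) \<and> is_square (a^2 + c^2) \<and> is_square (b^2 + c^2) \<and>
     is_square (a^2 + b^2 + c^2)"
  unfolding perfect_euler_box_def sqrt_of_nat_in_Ints_iff ..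

end

(* If n^2 + b^2 = x^2, then n^2 = (x - b)(x + b) is a factorisation of n^2 into two factors with
   difference 2b. For n = pq only four nonzero differences can occur. The other two sides and the
   diagonal of their common face are all legs of this kind, so one of the four squared differences
   would be the sum of two others, and explicit factorisations of the discrepancies rule this out. *)
theory Submission
  imports Defs
begin

text \<open>The exponents of \<open>p\<close> and \<open>q\<close> in the factor \<open>u\<close> =
  x - b form one of nine pairs. Exchanging \<open>u\<close> with its cofactor matches eight of them
  in twos, which gives the four values; the pair (1, 1) gives b = 0. Squaring 2b makes it irrelevant
  which factor is larger and turns the values into polynomials in \<open>P\<close> and
  \<open>Q\<close>.\<close>

lemma semiprime_leg_cases:
  fixes p q b :: nat
  assumes p: "prime p" and q: "prime q" and b: "b > 0"
    and sq: "is_square ((p * q)^2 + b^2)"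
  defines "P \<equiv> (int p)^2" and "Q \<equiv> (int q)^2"
  shows "4 * (int b)^2 \<in> {(P * Q - 1)^2, P * (Q - 1)^2, Q * (P - 1)^2, (Q - P)^2}"
proof -
  obtain x where x: "(p * q)^2 + b^2 = x^2"
    using sq by (auto elim: is_nth_powerE)
  have "b^2 \<le> x^2"
    using x by linarith
  then have bx: "b \<le> x"
    by (simp add: power2_nat_le_eq_le)
  define u v where "u = x - b" and "v = x + b"
  have "int u = int x - int b"
    using bx by (simp add: u_def)
  then have diff: "2 * int b = int v - int u"
    by (simp add: v_def)
  have uv: "u * v = p^2 * q^2"
  proof -
    have "int u * int v = (int x)^2 - (int b)^2"
      by (simp add: \<open>int u = _\<close> v_def power2_eq_square algebra_simps)
    also have "\<dots> = int ((p * q)^2)"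
      using arg_cong[OF x, of int] by simp
    finally show ?thesis
      by (simp add: power_mult_distrib flip: of_nat_mult of_nat_power)
  qed
  have "u dvd p^2 * q^2"
    by (simp flip: uv)
  \<comment> \<open>Splitting the divisor in this way also covers \<open>p\<close> =
    \<open>q\<close>, where the two prime powers are not coprime.\<close>
  then obtain s t where st: "u = s * t" "s dvd p^2" "t dvd q^2"
    using division_decomp by blast
  obtain i where i: "i \<le> 2" "s = p^i"
    using st(2) p by (auto simp: divides_primepow_nat)
  obtain j where j: "j \<le> 2" "t = q^j"
    using st(3) q by (auto simp: divides_primepow_nat)
  have pos: "p > 0" "q > 0"
    using p q by (auto simp: prime_gt_0_nat)
  \<comment> \<open>Cancelling \<open>u\<close> shows that \<open>v\<close> carries the
    complementary exponents.\<close>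
  have "u * v = (p^i * p^(2 - i)) * (q^j * q^(2 - j))"
    using i(1) j(1) by (simp add: uv flip: power_add)
  also have "\<dots> = u * (p^(2 - i) * q^(2 - j))"
    by (simp add: st(1) i(2) j(2))
  finally have "u * v = u * (p^(2 - i) * q^(2 - j))" .
  moreover have "u > 0"
    using pos by (simp add: st(1) i(2) j(2))
  ultimately have v: "v = p^(2 - i) * q^(2 - j)"
    by simp
  have "4 * (int b)^2 = (2 * int b)^2"
    by simp
  then have e: "4 * (int b)^2 = (int p^(2 - i) * int q^(2 - j) - int p^i * int q^j)^2"
    unfolding diff by (simp add: v st(1) i(2) j(2))
  have "i = 0 \<or> i = 1 \<or> i = 2" "j = 0 \<or> j = 1 \<or> j = 2"
    using i(1) j(1) by auto
  then show ?thesis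
    using e b by (elim disjE) (simp_all add: P_def Q_def power2_eq_square algebra_simps)
qed

text \<open>The value (PQ - 1)^2 exceeds the sum of any two of the others, and (Q - P)^2 is less
  than the sum of the middle two. Neither middle value is the sum of the other one and a positive (Q
  - P)^2. The condition \<open>B \<noteq> C\<close> excludes one value being twice another.\<close>

lemma leg_squares_sum_free:
  fixes P Q B C D :: int
  assumes P: "P \<ge> 2" and Q: "Q \<ge> 2" and BC: "D = B + C" "B \<noteq> C"
    and pos: "B > 0" "C > 0"
  defines "S \<equiv> {(P * Q - 1)^2, P * (Q - 1)^2, Q * (P - 1)^2, (Q - P)^2}"
  assumes mem: "B \<in> S" "C \<in> S" "D \<in> S"
  shows False
proof -
  define X1 X2 X3 X4 where X: "X1 = (P * Q - 1)^2" "X2 = P * (Q - 1)^2"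
    "X3 = Q * (P - 1)^2" "X4 = (Q - P)^2"
  \<comment> \<open>This is the cofactor of X1 - X3 - X4, and with the variables exchanged that of
    X1 - X2 - X4.\<close>
  have aux: "(R + 1) * (T^2 - 1) - T * (R - 1) > 0" if "R \<ge> 2" "T \<ge> 2" for R T :: int
  proof -
    have "T * 2 \<le> T * T"
      using that by (intro mult_left_mono) auto
    then have "T \<le> T^2 - 1"
      using that unfolding power2_eq_square by linarith
    then have "(R + 1) * T \<le> (R + 1) * (T^2 - 1)"
      using that by (intro mult_left_mono) auto
    then show ?thesis
      using that by (simp add: algebra_simps)
  qed
  have "X1 - X2 - X3 = (P - 1) * (Q - 1) * (P * Q + 1)"
    by (simp add: X power2_eq_square algebra_simps)
  moreover have "\<dots> > 0"
    using P Q by (intro mult_pos_pos add_pos_pos) auto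
  moreover have "X1 - X3 - X4 = (P - 1) * ((P + 1) * (Q^2 - 1) - Q * (P - 1))"
    by (simp add: X power2_eq_square algebra_simps)
  moreover have "\<dots> > 0"
    using P Q aux[of P Q] by (intro mult_pos_pos) auto
  moreover have "X1 - X2 - X4 = (Q - 1) * ((Q + 1) * (P^2 - 1) - P * (Q - 1))"
    by (simp add: X power2_eq_square algebra_simps)
  moreover have "\<dots> > 0"
    using P Q aux[of Q P] by (intro mult_pos_pos) auto
  moreover have "X2 + X3 - X4 = (P - 2) * Q^2 + (Q - 2) * P^2 + P + Q + (P - Q)^2"
    by (simp add: X power2_eq_square algebra_simps)
  moreover have "\<dots> > 0"
    using P Q by (intro add_pos_nonneg add_nonneg_pos) auto
  moreover have "X2 - X3 - X4 = (Q - P) * (P - 1) * (Q + 1)"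
    "X3 - X2 - X4 = (P - Q) * (Q - 1) * (P + 1)"
    by (simp_all add: X power2_eq_square algebra_simps)
  \<comment> \<open>Both differences vanish for \<open>P\<close> = \<open>Q\<close>, but then
    \<open>X4\<close> is 0 and cannot equal any of the positive numbers \<open>B\<close>,
    \<open>C\<close>, \<open>D\<close>.\<close>
  then have "X4 > 0 \<longrightarrow> X2 - X3 - X4 \<noteq> 0 \<and> X3 - X2 - X4 \<noteq> 0"
    using P Q by (auto simp: X(4))
  moreover have "X2 > 0" "X3 > 0" "X4 \<ge> 0"
    using P Q by (auto simp: X)
  moreover have "B = X1 \<or> B = X2 \<or> B = X3 \<or> B = X4" "C = X1 \<or> C = X2 \<or> C = X3 \<or> C = X4"
    "D = X1 \<or> D = X2 \<or> D = X3 \<or> D = X4"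
    using mem by (auto simp: S_def X)
  ultimately show False
    using BC pos by smt
qed

lemma not_is_square_2: "\<not> is_square (2 :: nat)"
proof
  assume "is_square (2 :: nat)"
  then obtain k :: nat where k: "2 = k^2"
    by (auto elim: is_nth_powerE)
  then have "k < 2"
    by (intro power_less_imp_less_base[of k 2]) auto
  then show False
    using k by (auto simp: less_2_cases_iff)
qed

lemma not_perfect_euler_box_semiprime:
  assumes box: "perfect_euler_box a b c" and "semiprime a"
  shows False
proof -
  obtain p q where p: "prime p" and q: "prime q" and a: "a = p * q"
    using \<open>semiprime a\<close> by (auto simp: semiprime_def)
  have pos: "b > 0" "c > 0"
    and sq: "is_square (a^2 + b^2)" "is_square (a^2 + c^2)" "is_square (b^2 + c^2)"
      "is_square (a^2 + b^2 + c^2)"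
    using box by (auto simp: perfect_euler_box_iff_squares)
  obtain d where d: "b^2 + c^2 = d^2"
    using sq(3) by (auto elim: is_nth_powerE)
  have "d > 0"
    using d pos by (cases "d = 0") auto
  \<comment> \<open>A face with equal sides would make 2 a square.\<close>
  have "b \<noteq> c"
  proof
    assume "b = c"
    then have "is_square (2 * c^2)"
      using sq(3) by (simp add: mult_2)
    then show False
      using not_is_square_2 pos by (simp add: is_nth_power_mult_cancel_right)
  qed
  have sqd: "is_square (a^2 + d^2)"
    using sq(4) by (simp add: d[symmetric] add.assoc)
  have ge: "(int r)^2 \<ge> 2" if "prime r" for r
    using power_mono[of 2 "int r" 2] prime_ge_2_nat[OF that] by simp
  note legs = semiprime_leg_cases[OF p q, folded a]
  have "(int b)^2 \<noteq> (int c)^2"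
    using \<open>b \<noteq> c\<close> by (simp add: power2_eq_iff_nonneg)
  \<comment> \<open>The lemma is applied to 4b^2, 4c^2 and 4d^2, whose relation is four times b^2 +
    c^2 = d^2.\<close>
  then show False
    using leg_squares_sum_free[OF ge[OF p] ge[OF q] _ _ _ _
        legs[OF pos(1) sq(1)] legs[OF pos(2) sq(2)] legs[OF \<open>d > 0\<close> sqd]]
      pos arg_cong[OF d, of int] by simp
qed

theorem theorem1:
  shows "\<not> (\<exists>a b c. perfect_euler_box a b c \<and> (semiprime a \<or> semiprime b \<or> semiprime c))"
proof -
  have "perfect_euler_box b a c" "perfect_euler_box c a b" if "perfect_euler_box a b c" for a b c
    using that by (simp_all add: perfect_euler_box_def ac_simps)
  then show ?thesis
    using not_perfect_euler_box_semiprime by blast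
qed

end
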